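(* Let $A\in\mathbb{R}^{n\times n}$ be invertible, let $W\in\mathbb{R}^{n\times n}$ be symmetric positive definite, let $X_k\in\mathbb{R}^{n\times n}$ and $S\in\mathbb{R}^{n\times q}$. (Row variant) The following two problems define the same matrix $X_{k+1}$: $$X_{k+1}=\arg\min_{X\in\mathbb{R}^{n\times n}}\tfrac12\|X-X_k\|_{F(W^{-1})}^2\quad\text{subject to}\quad S^TAX=S^T,\qquad (\mathrm{a})$$ $$X_{k+1}=\arg_X\min_{X\in\mathbb{R}^{n\times n},\,Y\in\mathbb{R}^{n\times q}}\tfrac12\|X-A^{-1}\|_{F(W^{-1})}^2\quad\text{subject to}\quad X=X_k+WA^TSY^T.\qquad (\mathrm{b})$$ (Column variant) The following two problems define the same matrix $X_{k+1}$: $$X_{k+1}=\arg\min_{X\in\mathbb{R}^{n\times n}}\tfrac12\|X-X_k\|_{F(W^{-1})}^2\quad\text{subject to}\quad XAS=S,\qquad (\mathrm{c})$$ $$X_{k+1}=\arg_X\min_{X\in\mathbb{R}^{n\times n},\,Y\in\mathbb{R}^{n\times q}}\tfrac12\|X-A^{-1}\|_{F(W^{-1})}^2\quad\text{subject to}\quad X=X_k+YS^TA^TW.\qquad (\mathrm{d})$$ Further, if $S$ has full column rank, then the explicit solution to (a) is $$X_{k+1}=X_k+WA^TS(S^TAWA^TS)^{-1}S^T(I-AX_k),$$ and the explicit solution to (c) is $$X_{k+1}=X_k+(I-X_kA)S(S^TA^TWAS)^{-1}S^TA^TW.$$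
   Context: $I$ is the $n\times n$ identity matrix. For symmetric positive definite $W$, the weighted Frobenius norm is $\|X\|_{F(W^{-1})}^2=\mathrm{Tr}(X^TW^{-1}XW^{-1})=\|W^{-1/2}XW^{-1/2}\|_F^2$, where $\|\cdot\|_F$ is the standard Frobenius norm. The notation $\arg_X\min_{X,Y}$ means that the minimization is over the pair $(X,Y)$ and the $X$-component of a minimizer is returned. *)

theory Defs
  imports "HOL-Analysis.Analysis"
begin

definition sym_pos_def :: "real^'n^'n \<Rightarrow> bool" where
  "sym_pos_def W \<longleftrightarrow> transpose W = W \<and> (\<forall>x. x \<noteq> 0 \<longrightarrow> 0 < x \<bullet> (W *v x))"

(* The norm written F(M), for a symmetric positive definite weight M; it is used below
   with M = matrix_inv W. *)
definition wfrob_norm :: "real^'n^'n \<Rightarrow> real^'n^'n \<Rightarrow> real" where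
  "wfrob_norm M X = sqrt (trace (transpose X ** M ** X ** M))"

(* The library norm on real^'n^'n is the standard Frobenius norm. *)
lemma norm_matrix_eq_sqrt_trace:
  fixes X :: "real^'n^'m"
  shows "norm X = sqrt (trace (transpose X ** X))"
proof -
  have "trace (transpose X ** X) = (\<Sum>i\<in>UNIV. \<Sum>k\<in>UNIV. X $ k $ i * X $ k $ i)"
    by (simp add: trace_def matrix_matrix_mult_def transpose_def)
  also have "\<dots> = (\<Sum>k\<in>UNIV. \<Sum>i\<in>UNIV. X $ k $ i * X $ k $ i)"
    by (rule sum.swap)
  also have "\<dots> = X \<bullet> X"
    by (simp add: inner_vec_def)
  finally show ?thesis
    by (simp add: norm_eq_sqrt_inner)
qed

(* With M = W^{-1} and R = W^{-1/2}. *)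
lemma wfrob_norm_eq_norm:
  fixes M R X :: "real^'n^'n"
  assumes "transpose R = R" and "R ** R = M"
  shows "wfrob_norm M X = norm (R ** X ** R)"
proof -
  have "transpose X ** M ** X ** M = (transpose X ** R ** R ** X ** R) ** R"
    by (simp add: assms(2)[symmetric] matrix_mul_assoc)
  then have "trace (transpose X ** M ** X ** M)
      = trace ((transpose X ** R ** R ** X ** R) ** R)"
    by (rule arg_cong)
  also have "\<dots> = trace (R ** (transpose X ** R ** R ** X ** R))"
    by (rule trace_mul_sym)
  also have "R ** (transpose X ** R ** R ** X ** R)
      = transpose (R ** X ** R) ** (R ** X ** R)"
    by (simp add: matrix_transpose_mul assms(1) matrix_mul_assoc)
  finally show ?thesis
    by (simp add: wfrob_norm_def norm_matrix_eq_sqrt_trace)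
qed

(* The four problems are represented by their full solution sets, so that "the problem
   defines the matrix X'" reads "the solution set is {X'}". For the problems in (X, Y) only
   the X-components of the minimizing pairs are collected; Y need not be unique. *)

definition row_proj_sols ::
  "real^'n^'n \<Rightarrow> real^'n^'n \<Rightarrow> real^'n^'n \<Rightarrow> real^'q^'n \<Rightarrow> (real^'n^'n) set" where
  "row_proj_sols A W Xk S =
     {X. is_arg_min
           (\<lambda>X. 1/2 * (wfrob_norm (matrix_inv W) (X - Xk))\<^sup>2)
           (\<lambda>X. transpose S ** A ** X = transpose S) X}"

definition row_approx_sols ::
  "real^'n^'n \<Rightarrow> real^'n^'n \<Rightarrow> real^'n^'n \<Rightarrow> real^'q^'n \<Rightarrow> (real^'n^'n) set" where
  "row_approx_sols A W Xk S =
     {X. \<exists>Y :: real^'q^'n. is_arg_min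
           (\<lambda>(X, Y). 1/2 * (wfrob_norm (matrix_inv W) (X - matrix_inv A))\<^sup>2)
           (\<lambda>(X, Y). X = Xk + W ** transpose A ** S ** transpose Y) (X, Y)}"

definition col_proj_sols ::
  "real^'n^'n \<Rightarrow> real^'n^'n \<Rightarrow> real^'n^'n \<Rightarrow> real^'q^'n \<Rightarrow> (real^'n^'n) set" where
  "col_proj_sols A W Xk S =
     {X. is_arg_min
           (\<lambda>X. 1/2 * (wfrob_norm (matrix_inv W) (X - Xk))\<^sup>2)
           (\<lambda>X. X ** A ** S = S) X}"

definition col_approx_sols ::
  "real^'n^'n \<Rightarrow> real^'n^'n \<Rightarrow> real^'n^'n \<Rightarrow> real^'q^'n \<Rightarrow> (real^'n^'n) set" where
  "col_approx_sols A W Xk S =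
     {X. \<exists>Y :: real^'q^'n. is_arg_min
           (\<lambda>(X, Y). 1/2 * (wfrob_norm (matrix_inv W) (X - matrix_inv A))\<^sup>2)
           (\<lambda>(X, Y). X = Xk + Y ** transpose S ** transpose A ** W) (X, Y)}"

end

(* Put C = A^T S and B(X, Y) = Tr(X^T W^{-1} Y W^{-1}). The feasible set of (a) is
   A^{-1} + {D. C^T D = 0}, that of (b) is X_k + {W C Y^T}, and the two linear subspaces are
   B-orthogonal. The affine sets meet, because the normal equation
   C^T W C Z = C^T (A^{-1} - X_k) is solvable even when C is rank deficient. By Pythagoras a
   common point is the unique minimizer of both problems. For S of full column rank C^T W C is
   invertible, which gives the explicit formula. Transposition turns the column problems into
   row problems for A^T and X_k^T. *)
theory Submission
  imports Defs
begin

section \<open>Rank-one matrices, transposes and inverses\<close>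

definition outer :: "real^'m \<Rightarrow> real^'n \<Rightarrow> real^'n^'m" where
  "outer u v = (\<chi> i j. u $ i * v $ j)"

lemma outer_mult_vec: "outer u v *v y = (v \<bullet> y) *\<^sub>R u"
  by (vector outer_def matrix_vector_mult_def inner_vec_def sum_distrib_left mult_ac)

lemma matrix_mult_outer: "A ** outer u v = outer (A *v u) v"
  by (vector outer_def matrix_matrix_mult_def matrix_vector_mult_def
      sum_distrib_left sum_distrib_right mult_ac)

lemma trace_outer: "trace (outer u v) = u \<bullet> v"
  by (simp add: trace_def outer_def inner_vec_def)

lemma transpose_outer: "transpose (outer u v) = outer v u"
  by (vector outer_def transpose_def mult_ac)

lemma trace_transpose: "trace (transpose A) = trace A"
  by (simp add: trace_def transpose_def)

lemma transpose_add: "transpose (A + B) = transpose A + transpose B"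
  by (vector transpose_def)

lemma transpose_diff:
  fixes A B :: "real^'n^'m"
  shows "transpose (A - B) = transpose A - transpose B"
  by (vector transpose_def)

lemma matrix_add_rdistrib:
  fixes A B :: "real^'n^'m"
  shows "(A + B) ** C = A ** C + B ** C"
  by (vector matrix_matrix_mult_def sum.distrib algebra_simps)

lemma matrix_diff_ldistrib:
  fixes A :: "real^'n^'m"
  shows "A ** (B - C) = A ** B - A ** C"
  by (vector matrix_matrix_mult_def sum_subtractf algebra_simps)

lemma inner_mult_vec_transpose:
  fixes A :: "real^'n^'m"
  shows "x \<bullet> (A *v y) = (transpose A *v x) \<bullet> y"
  by (simp add: dot_lmul_matrix)

lemma matrix_inv_mult:
  assumes "invertible A"
  shows "A ** matrix_inv A = mat 1" and "matrix_inv A ** A = mat 1"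
  using someI_ex[OF assms[unfolded invertible_def]] by (simp_all add: matrix_inv_def)

lemma matrix_inv_transpose:
  fixes A :: "real^'n^'n"
  assumes "invertible A"
  shows "matrix_inv (transpose A) = transpose (matrix_inv A)"
proof -
  have "transpose (matrix_inv A) ** transpose A = mat 1"
    by (simp add: matrix_inv_mult[OF assms] flip: matrix_transpose_mul)
  then have "transpose (matrix_inv A) = transpose (matrix_inv A) ** (transpose A ** matrix_inv (transpose A))"
    using assms by (simp add: matrix_inv_mult transpose_invertible)
  then show ?thesis
    using \<open>transpose (matrix_inv A) ** transpose A = mat 1\<close> by (simp add: matrix_mul_assoc)
qed

section \<open>Positive definite matrices and positivity of the trace form\<close>

lemma sym_pos_def_pos: "sym_pos_def W \<Longrightarrow> x \<noteq> 0 \<Longrightarrow> 0 < x \<bullet> (W *v x)"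
  by (simp add: sym_pos_def_def)

lemma sym_pos_def_transpose: "sym_pos_def W \<Longrightarrow> transpose W = W"
  by (simp add: sym_pos_def_def)

lemma sym_pos_def_nonneg: "sym_pos_def W \<Longrightarrow> 0 \<le> x \<bullet> (W *v x)"
  using sym_pos_def_pos[of W x] by (cases "x = 0") auto

lemma sym_pos_def_zero: "sym_pos_def W \<Longrightarrow> x \<bullet> (W *v x) = 0 \<Longrightarrow> x = 0"
  using sym_pos_def_pos[of W x] by fastforce

lemma invertible_if_ker_trivial:
  fixes A :: "real^'n^'n"
  assumes "\<And>x. A *v x = 0 \<Longrightarrow> x = 0"
  shows "invertible A"
  using assms invertible_left_inverse matrix_left_invertible_ker by blast

lemma sym_pos_def_invertible: "sym_pos_def W \<Longrightarrow> invertible W"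
  by (rule invertible_if_ker_trivial) (auto intro: sym_pos_def_zero)

text \<open>The substitution \<open>x = W *v y\<close> turns the quadratic form of the inverse at
  \<open>x\<close> into that of \<open>W\<close> at \<open>y\<close>.\<close>

lemma sym_pos_def_matrix_inv:
  assumes W: "sym_pos_def W"
  shows "sym_pos_def (matrix_inv W)"
  unfolding sym_pos_def_def
proof (intro conjI allI impI)
  note inv = sym_pos_def_invertible[OF W]
  show "transpose (matrix_inv W) = matrix_inv W"
    using matrix_inv_transpose[OF inv] sym_pos_def_transpose[OF W] by simp
  fix x :: "real^'a" assume x: "x \<noteq> 0"
  define y where "y = matrix_inv W *v x"
  have xy: "x = W *v y"
    by (simp add: y_def matrix_vector_mul_assoc matrix_inv_mult[OF inv])
  with x have "y \<noteq> 0"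
    by auto
  then have "0 < y \<bullet> (W *v y)"
    by (rule sym_pos_def_pos[OF W])
  then show "0 < x \<bullet> (matrix_inv W *v x)"
    by (simp add: xy matrix_vector_mul_assoc matrix_inv_mult[OF inv] inner_commute)
qed

text \<open>Instead of a square root of \<open>M\<close>, the induction subtracts rank-one matrices
  \<open>M x (M x)\<^sup>T / (x\<^sup>T M x)\<close>, which keeps the remainder positive semidefinite
  and lowers its rank.\<close>

lemma trace_congruence_mult_psd:
  fixes M :: "real^'n^'n" and X :: "real^'n^'m" and G :: "real^'m^'m"
  assumes G: "sym_pos_def G"
    and "transpose M = M" and "\<And>x. 0 \<le> x \<bullet> (M *v x)"
  shows "0 \<le> trace (transpose X ** G ** X ** M) \<and>
    (trace (transpose X ** G ** X ** M) = 0 \<longrightarrow> X ** M = 0)"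
  using assms(2,3)
proof (induction "rank M" arbitrary: M rule: less_induct)
  case less
  note sym = less.prems(1) and psd = less.prems(2)
  have swap: "y \<bullet> (M *v z) = z \<bullet> (M *v y)" for y z
    by (metis inner_commute inner_mult_vec_transpose sym)
  show ?case
  proof (cases "\<forall>x. x \<bullet> (M *v x) = 0")
    case True
    \<comment> \<open>Polarization: expanding the form at \<open>y + z\<close> leaves twice this
      cross term, by symmetry of \<open>M\<close>.\<close>
    have "y \<bullet> (M *v z) = 0" for y z
    proof -
      have "(y + z) \<bullet> (M *v (y + z)) = 0" "y \<bullet> (M *v y) = 0" "z \<bullet> (M *v z) = 0"
        using True by auto
      then show ?thesis
        using swap[of y z] by (simp add: matrix_vector_right_distrib inner_add_left inner_add_right)
    qed
    then have "M *v z = 0" for z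
      using inner_eq_zero_iff by blast
    then have "M = 0"
      by (simp add: matrix_eq)
    then show ?thesis
      by (simp add: trace_0[unfolded mat_0])
  next
    case False
    then obtain x where x: "x \<bullet> (M *v x) \<noteq> 0"
      by blast
    define c where "c = x \<bullet> (M *v x)"
    define u where "u = M *v x"
    define O1 where "O1 = outer (u /\<^sub>R c) u"
    define M' where "M' = M - O1"
    have c: "0 < c"
      using x psd[of x] by (simp add: c_def)
    have M: "M = M' + O1"
      by (simp add: M'_def)
    \<comment> \<open>\<open>M'\<close> is \<open>M\<close> applied after the
      \<open>M\<close>-orthogonal projection along \<open>x\<close>, because
      \<open>u \<bullet> y\<close> is the \<open>M\<close>-product of \<open>x\<close> and
      \<open>y\<close>, and \<open>c\<close> that of \<open>x\<close> with itself.\<close>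
    have M'v: "M' *v y = M *v (y - ((u \<bullet> y) / c) *\<^sub>R x)" for y
      by (simp add: M'_def O1_def outer_mult_vec u_def matrix_vector_mult_diff_rdistrib
          matrix_vector_mult_diff_distrib matrix_vector_mult_scaleR divide_inverse)
    have xM': "x \<bullet> (M' *v y) = 0" for y
      using c swap[of x y] unfolding M'v
      by (simp add: matrix_vector_mult_diff_distrib matrix_vector_mult_scaleR inner_diff_right
          c_def u_def inner_commute)
    have "transpose M' = M'"
      by (simp add: M'_def transpose_diff sym O1_def transpose_outer)
        (vector outer_def)
    moreover have "0 \<le> y \<bullet> (M' *v y)" for y
    proof -
      \<comment> \<open>The range of \<open>M'\<close> is orthogonal to \<open>x\<close>, so
        \<open>y\<close> may be replaced by its projection on the left; the right-hand side is then
        the form of \<open>M\<close> at the projected vector.\<close>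
      have "y \<bullet> (M' *v y) = (y - ((u \<bullet> y) / c) *\<^sub>R x) \<bullet> (M' *v y)"
        by (simp add: inner_diff_left xM')
      also have "\<dots> \<ge> 0"
        unfolding M'v by (rule psd)
      finally show ?thesis .
    qed
    moreover have "rank M' < rank M"
    proof -
      have sub: "range ((*v) M') \<subseteq> range ((*v) M)"
        using M'v by auto
      \<comment> \<open>Every vector of the range of \<open>M'\<close> is orthogonal to
        \<open>x\<close>, whereas \<open>x \<bullet> (M *v x)\<close> is nonzero. The inclusion of
        ranges is therefore strict and the rank drops.\<close>
      have "M *v x \<notin> range ((*v) M')"
        using x xM' by auto
      with sub have "range ((*v) M') \<subset> range ((*v) M)"
        by blast
      then have "span (range ((*v) M')) \<subset> span (range ((*v) M))"
        by (simp add: span_eq_iff[THEN iffD2] linear_subspace_image)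
      then show ?thesis
        unfolding rank_dim_range by (rule dim_psubset)
    qed
    ultimately have IH: "0 \<le> trace (transpose X ** G ** X ** M')"
        "trace (transpose X ** G ** X ** M') = 0 \<Longrightarrow> X ** M' = 0"
      using less.hyps by blast+
    define w where "w = X *v u"
    \<comment> \<open>The rank-one part contributes the form of \<open>G\<close> at
      \<open>X *v u\<close>, divided by \<open>c\<close>. The trace thus splits into two nonnegative
      terms, and if it vanishes then both do.\<close>
    have "trace (transpose X ** G ** X ** O1) = (transpose X ** G ** X *v (u /\<^sub>R c)) \<bullet> u"
      by (simp add: O1_def matrix_mult_outer trace_outer)
    also have "\<dots> = (w \<bullet> (G *v w)) / c"
      using dot_lmul_matrix[of "G *v w" X u]
      by (simp add: w_def matrix_vector_mult_scaleR divide_inverse inner_commute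
          flip: matrix_vector_mul_assoc)
    finally have tr: "trace (transpose X ** G ** X ** M)
        = trace (transpose X ** G ** X ** M') + (w \<bullet> (G *v w)) / c"
      by (simp add: M matrix_add_ldistrib trace_add)
    have w: "0 \<le> (w \<bullet> (G *v w)) / c"
      using c sym_pos_def_nonneg[OF G] by simp
    show ?thesis
    proof (intro conjI impI)
      show "0 \<le> trace (transpose X ** G ** X ** M)"
        using tr w IH(1) by linarith
      assume "trace (transpose X ** G ** X ** M) = 0"
      then have "trace (transpose X ** G ** X ** M') = 0" and "(w \<bullet> (G *v w)) / c = 0"
        using tr w IH(1) by linarith+
      then have "X ** M' = 0" and "w = 0"
        using IH(2) c sym_pos_def_zero[OF G] by auto
      moreover have "X ** O1 = outer (w /\<^sub>R c) u"
        by (simp add: O1_def matrix_mult_outer matrix_vector_mult_scaleR w_def)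
      ultimately show "X ** M = 0"
        by (simp add: M matrix_add_ldistrib) (vector outer_def)
    qed
  qed
qed

section \<open>Weighted Frobenius norm: definiteness and Pythagoras\<close>

text \<open>The trace under \<open>sqrt\<close> is nonnegative, by
  \<open>trace_congruence_mult_psd\<close> with \<open>M = G\<close>.\<close>

lemma wfrob_norm_sq:
  assumes G: "sym_pos_def G"
  shows "(wfrob_norm G X)\<^sup>2 = trace (transpose X ** G ** X ** G)"
  using trace_congruence_mult_psd[OF G sym_pos_def_transpose[OF G] sym_pos_def_nonneg[OF G],
      THEN conjunct1]
  by (simp add: wfrob_norm_def)

text \<open>A vanishing trace would force \<open>X ** G = 0\<close>, and \<open>G\<close> can be
  cancelled.\<close>

lemma wfrob_norm_sq_pos:
  assumes G: "sym_pos_def G" and "X \<noteq> 0"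
  shows "0 < (wfrob_norm G X)\<^sup>2"
proof -
  have "X ** G ** matrix_inv G = X"
    by (simp add: matrix_inv_mult[OF sym_pos_def_invertible[OF G]] flip: matrix_mul_assoc)
  then have "X ** G \<noteq> 0"
    using assms(2) by auto
  then show ?thesis
    using trace_congruence_mult_psd[OF G sym_pos_def_transpose[OF G] sym_pos_def_nonneg[OF G], of X]
    unfolding wfrob_norm_sq[OF G] by linarith
qed

lemma wfrob_norm_transpose:
  assumes "transpose G = G"
  shows "wfrob_norm G (transpose X) = wfrob_norm G X"
proof -
  have "trace ((X ** G) ** (transpose X ** G)) = trace ((transpose X ** G) ** (X ** G))"
    by (rule trace_mul_sym)
  then show ?thesis
    by (simp add: wfrob_norm_def matrix_mul_assoc)
qed

text \<open>Pythagoras for Tr(P^T G Q G). Transposition and cyclicity of the trace identify the two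
  cross terms, so one orthogonality hypothesis removes both.\<close>

lemma wfrob_norm_sq_add:
  assumes G: "sym_pos_def G" and "trace (transpose P ** G ** Q ** G) = 0"
  shows "(wfrob_norm G (P + Q))\<^sup>2 = (wfrob_norm G P)\<^sup>2 + (wfrob_norm G Q)\<^sup>2"
proof -
  have "trace (transpose Q ** G ** P ** G) = trace (transpose (G ** transpose P ** G ** Q))"
    by (simp add: matrix_transpose_mul sym_pos_def_transpose[OF G] matrix_mul_assoc)
  also have "\<dots> = trace (G ** (transpose P ** G ** Q))"
    by (simp add: trace_transpose matrix_mul_assoc)
  also have "\<dots> = 0"
    using assms(2) trace_mul_sym[of G "transpose P ** G ** Q"] by simp
  finally show ?thesis
    using assms(2) unfolding wfrob_norm_sq[OF G]
    by (simp add: transpose_add matrix_add_ldistrib matrix_add_rdistrib trace_add)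
qed

text \<open>In the cross term \<open>W\<close> cancels against its inverse, which leaves the factor
  \<open>transpose C ** D\<close>.\<close>

lemma wfrob_norm_sq_add_orthogonal:
  fixes W D :: "real^'n^'n" and C Y :: "real^'q^'n"
  assumes W: "sym_pos_def W" and D: "transpose C ** D = 0"
  shows "(wfrob_norm (matrix_inv W) (W ** C ** transpose Y + D))\<^sup>2
    = (wfrob_norm (matrix_inv W) (W ** C ** transpose Y))\<^sup>2 + (wfrob_norm (matrix_inv W) D)\<^sup>2"
proof (rule wfrob_norm_sq_add[OF sym_pos_def_matrix_inv[OF W]])
  have "transpose (W ** C ** transpose Y) ** matrix_inv W ** D ** matrix_inv W
      = Y ** transpose C ** (W ** matrix_inv W) ** D ** matrix_inv W"
    by (simp add: matrix_transpose_mul sym_pos_def_transpose[OF W] matrix_mul_assoc)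
  also have "\<dots> = Y ** (transpose C ** D) ** matrix_inv W"
    by (simp add: matrix_inv_mult[OF sym_pos_def_invertible[OF W]] matrix_mul_assoc)
  also have "\<dots> = 0"
    by (simp add: D)
  finally show "trace (transpose (W ** C ** transpose Y) ** matrix_inv W ** D ** matrix_inv W) = 0"
    by (simp add: trace_0[unfolded mat_0])
qed

section \<open>Weighted normal equations\<close>

text \<open>Pairing the vanishing vector with \<open>z\<close> gives the form of \<open>W\<close> at
  \<open>C *v z\<close>, which is definite.\<close>

lemma gram_ker:
  fixes W :: "real^'n^'n" and C :: "real^'q^'n"
  assumes W: "sym_pos_def W" and "transpose C ** W ** C *v z = 0"
  shows "C *v z = 0"
proof (rule sym_pos_def_zero[OF W])
  have "(C *v z) \<bullet> (W *v (C *v z)) = z \<bullet> (transpose C ** W ** C *v z)"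
    using dot_lmul_matrix[of "W *v (C *v z)" C z]
    by (simp add: inner_commute flip: matrix_vector_mul_assoc)
  then show "(C *v z) \<bullet> (W *v (C *v z)) = 0"
    by (simp add: assms(2))
qed

text \<open>The Gram matrix \<open>K\<close> may be singular, but its range contains that of C^T: a
  vector orthogonal to the range of \<open>K\<close> lies in the kernel of \<open>C\<close>. The
  equation is solved column by column.\<close>

lemma weighted_normal_equation_solvable:
  fixes W R :: "real^'n^'n" and C :: "real^'q^'n"
  assumes W: "sym_pos_def W"
  obtains Z where "transpose C ** W ** C ** Z = transpose C ** R"
proof -
  define K where "K = transpose C ** W ** C"
  have K: "transpose K = K"
    by (simp add: K_def matrix_transpose_mul sym_pos_def_transpose[OF W] matrix_mul_assoc)
  have "\<exists>z. K *v z = transpose C *v r" for r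
  proof -
    \<comment> \<open>Split C^T r into a part \<open>y\<close> in the range of \<open>K\<close> and
      a part \<open>v\<close> orthogonal to it; the aim is \<open>v = 0\<close>.\<close>
    obtain y v where y: "y \<in> span (range ((*v) K))"
      and v: "\<And>w. w \<in> span (range ((*v) K)) \<Longrightarrow> orthogonal v w"
      and yv: "transpose C *v r = y + v"
      using orthogonal_subspace_decomp_exists by blast
    have "v \<bullet> (K *v w) = 0" for w
      using v[of "K *v w"] by (simp add: span_base orthogonal_def)
    \<comment> \<open>Take \<open>w = K *v v\<close> and move one factor \<open>K\<close> across the
      inner product by symmetry.\<close>
    then have "(K *v v) \<bullet> (K *v v) = 0"
      by (metis K inner_mult_vec_transpose)
    then have "K *v v = 0"
      by simp
    then have "C *v v = 0"
      unfolding K_def by (rule gram_ker[OF W])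
    then have "v \<bullet> (transpose C *v r) = 0"
      by (subst inner_mult_vec_transpose) simp
    moreover have "v \<bullet> y = 0"
      using v[OF y] by (simp add: orthogonal_def)
    ultimately have "v \<bullet> v = 0"
      unfolding yv by (simp add: inner_add_right)
    then have "v = 0"
      by simp
    moreover have "y \<in> range ((*v) K)"
      using y by (simp add: span_eq_iff[THEN iffD2] linear_subspace_image)
    ultimately show ?thesis
      using yv by auto
  qed
  then obtain f where f: "\<And>r. K *v f r = transpose C *v r"
    by metis
  define Z :: "real^'n^'q" where "Z = (\<chi> i j. f (column j R) $ i)"
  have "column j (K ** Z) = K *v f (column j R)" for j
    by (vector Z_def column_def matrix_matrix_mult_def matrix_vector_mult_def)
  moreover have "column j (transpose C ** R) = transpose C *v column j R" for j
    by (vector column_def matrix_matrix_mult_def matrix_vector_mult_def)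
  ultimately have "column j (K ** Z) = column j (transpose C ** R)" for j
    by (simp only: f)
  then have "K ** Z = transpose C ** R"
    by (simp add: column_def vec_eq_iff)
  then show thesis
    using that by (simp add: K_def)
qed

section \<open>Minimizers and the row problems\<close>

lemma is_arg_min_unique:
  fixes f :: "'a \<Rightarrow> 'b :: linorder"
  assumes "P m" and "\<And>x. P x \<Longrightarrow> x \<noteq> m \<Longrightarrow> f m < f x"
  shows "{x. is_arg_min f P x} = {m}"
  using assms unfolding is_arg_min_def by (auto dest: less_asym)

text \<open>Change of variables: by surjectivity every competitor has the form \<open>h x\<close>.
  This later transports minimizers along transposition.\<close>

lemma is_arg_min_surj:
  assumes "surj h" and "\<And>x. f' (h x) = f x" and "\<And>x. P' (h x) \<longleftrightarrow> P x"
  shows "is_arg_min f' P' (h x) \<longleftrightarrow> is_arg_min f P x"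
  unfolding is_arg_min_def by (metis assms surjE)

text \<open>A point common to both affine feasible sets solves both problems: from it, each set runs
  along one of two orthogonal subspaces, and the target of the problem is reached along the
  other.\<close>

lemma row_sols_eq:
  fixes A W Xk :: "real^'n^'n" and S Y :: "real^'q^'n"
  assumes A: "invertible A" and W: "sym_pos_def W"
    and X: "X = Xk + W ** transpose A ** S ** transpose Y"
    and feas: "transpose S ** A ** X = transpose S"
  shows "row_proj_sols A W Xk S = {X}" and "row_approx_sols A W Xk S = {X}"
proof -
  let ?N = "\<lambda>X. (wfrob_norm (matrix_inv W) X)\<^sup>2"
  define C where "C = transpose A ** S"
  have C: "transpose S ** A = transpose C" "W ** transpose A ** S = W ** C"
    by (simp_all add: C_def matrix_transpose_mul matrix_mul_assoc)
  note pos = wfrob_norm_sq_pos[OF sym_pos_def_matrix_inv[OF W]]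
  have "1/2 * ?N (X - Xk) < 1/2 * ?N (Z - Xk)"
    if "transpose S ** A ** Z = transpose S" "Z \<noteq> X" for Z
  proof -
    \<comment> \<open>Subtract the constraints at \<open>Z\<close> and \<open>X\<close>. The other
      leg of the right triangle is \<open>X - Xk\<close>, which is
      \<open>W ** C ** transpose Y\<close>.\<close>
    have "transpose C ** (Z - X) = 0"
      using that feas by (simp add: C matrix_diff_ldistrib)
    from wfrob_norm_sq_add_orthogonal[OF W this, of Y]
    have "?N (Z - Xk) = ?N (X - Xk) + ?N (Z - X)"
      by (simp add: X C algebra_simps)
    then show ?thesis
      using pos[of "Z - X"] that(2) by simp
  qed
  then show "row_proj_sols A W Xk S = {X}"
    unfolding row_proj_sols_def using feas by (intro is_arg_min_unique)
  have less: "1/2 * ?N (X - matrix_inv A) < 1/2 * ?N (Z - matrix_inv A)"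
    if "Z = Xk + W ** transpose A ** S ** transpose V" "Z \<noteq> X" for Z and V :: "real^'q^'n"
  proof -
    have "transpose S ** A ** matrix_inv A = transpose S"
      by (simp add: matrix_inv_mult[OF A] flip: matrix_mul_assoc)
    \<comment> \<open>The inverse of \<open>A\<close> is itself feasible for the projection problem.
      Here \<open>Z - X\<close> is the leg of the form
      \<open>W ** C ** transpose (V - Y)\<close>.\<close>
    then have "transpose C ** (X - matrix_inv A) = 0"
      using feas by (simp add: C matrix_diff_ldistrib)
    from wfrob_norm_sq_add_orthogonal[OF W this, of "V - Y"]
    have "?N ((Z - X) + (X - matrix_inv A)) = ?N (Z - X) + ?N (X - matrix_inv A)"
      using that(1) by (simp add: X C transpose_diff matrix_diff_ldistrib)
    then show ?thesis
      using pos[of "Z - X"] that(2) by simp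
  qed
  let ?T = "\<lambda>V :: real^'q^'n. Xk + W ** transpose A ** S ** transpose V"
  have mem: "Z \<in> row_approx_sols A W Xk S \<longleftrightarrow> (\<exists>V. Z = ?T V) \<and>
      (\<forall>V. 1/2 * ?N (Z - matrix_inv A) \<le> 1/2 * ?N (?T V - matrix_inv A))" for Z
    by (simp add: row_approx_sols_def is_arg_min_linorder)
  \<comment> \<open>When \<open>C\<close> is rank deficient, several \<open>V\<close> can give the
    same matrix \<open>X\<close>; the case split covers these ties.\<close>
  have le: "1/2 * ?N (X - matrix_inv A) \<le> 1/2 * ?N (?T V - matrix_inv A)" for V
    using less[OF refl, of V] by (cases "?T V = X") auto
  show "row_approx_sols A W Xk S = {X}"
  proof (intro equalityI subsetI)
    fix Z assume "Z \<in> row_approx_sols A W Xk S"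
    then obtain V where "Z = ?T V"
      and "1/2 * ?N (Z - matrix_inv A) \<le> 1/2 * ?N (?T Y - matrix_inv A)"
      unfolding mem by metis
    then have "\<not> 1/2 * ?N (X - matrix_inv A) < 1/2 * ?N (Z - matrix_inv A)"
      unfolding X by (simp only: not_less)
    then show "Z \<in> {X}"
      using less[OF \<open>Z = ?T V\<close>] by blast
  next
    fix Z assume "Z \<in> {X}"
    then have "Z = X"
      by simp
    show "Z \<in> row_approx_sols A W Xk S"
      unfolding mem \<open>Z = X\<close> by (intro conjI allI le exI[of _ Y] X)
  qed
qed

text \<open>A solution \<open>Z\<close> of the normal equation with right-hand side
  \<open>matrix_inv A - Xk\<close> makes the point with \<open>Y = transpose Z\<close> feasible for
  both problems.\<close>

lemma row_sols_exist:
  fixes A W Xk :: "real^'n^'n" and S :: "real^'q^'n"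
  assumes A: "invertible A" and W: "sym_pos_def W"
  shows "\<exists>X. row_proj_sols A W Xk S = {X} \<and> row_approx_sols A W Xk S = {X}"
proof -
  define C where "C = transpose A ** S"
  obtain Z where Z: "transpose C ** W ** C ** Z = transpose C ** (matrix_inv A - Xk)"
    using weighted_normal_equation_solvable[OF W] .
  have C: "transpose S ** A = transpose C"
    by (simp add: C_def matrix_transpose_mul)
  have "transpose C ** matrix_inv A = transpose S"
    by (simp add: matrix_inv_mult[OF A] flip: C matrix_mul_assoc)
  then have "transpose S ** A ** (Xk + W ** transpose A ** S ** transpose (transpose Z)) = transpose S"
    using Z C_def by (simp add: C matrix_add_ldistrib matrix_diff_ldistrib matrix_mul_assoc)
  then show ?thesis
    using row_sols_eq[OF A W refl] by blast
qed

text \<open>This is the \<open>W\<close>-weighted Gram matrix of A^T S, and A^T S is injective since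
  A^T is invertible and \<open>S\<close> has full column rank.\<close>

lemma gram_invertible:
  fixes A W :: "real^'n^'n" and S :: "real^'q^'n"
  assumes A: "invertible A" and W: "sym_pos_def W" and S: "rank S = CARD('q)"
  shows "invertible (transpose S ** A ** W ** transpose A ** S)"
proof (rule invertible_if_ker_trivial)
  fix z assume "transpose S ** A ** W ** transpose A ** S *v z = 0"
  then have "transpose (transpose A ** S) ** W ** (transpose A ** S) *v z = 0"
    by (simp add: matrix_transpose_mul matrix_mul_assoc)
  then have "transpose A *v (S *v z) = 0"
    unfolding matrix_vector_mul_assoc by (rule gram_ker[OF W])
  then have "matrix_inv (transpose A) ** transpose A *v (S *v z) = 0"
    by (simp only: matrix_vector_mul_assoc[symmetric] matrix_vector_mult_0_right)
  then have "S *v z = S *v 0"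
    by (simp add: matrix_inv_mult(2)[OF transpose_invertible[OF A]])
  then show "z = 0"
    using S by (blast dest: injD full_rank_injective[THEN iffD1])
qed

text \<open>Inverting the Gram matrix solves the normal equation explicitly, and the resulting point
  is common to both feasible sets.\<close>

lemma row_proj_sols_full_rank:
  fixes A W Xk :: "real^'n^'n" and S :: "real^'q^'n"
  assumes A: "invertible A" and W: "sym_pos_def W" and S: "rank S = CARD('q)"
  shows "row_proj_sols A W Xk S =
    {Xk + W ** transpose A ** S ** matrix_inv (transpose S ** A ** W ** transpose A ** S)
          ** transpose S ** (mat 1 - A ** Xk)}"
proof -
  define K where "K = transpose S ** A ** W ** transpose A ** S"
  define Z where "Z = matrix_inv K ** transpose S ** (mat 1 - A ** Xk)"
  have "K ** Z = K ** matrix_inv K ** transpose S ** (mat 1 - A ** Xk)"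
    by (simp add: Z_def matrix_mul_assoc)
  also have "\<dots> = transpose S - transpose S ** A ** Xk"
    by (simp add: K_def matrix_inv_mult[OF gram_invertible[OF assms]] matrix_diff_ldistrib
        matrix_mul_assoc)
  finally have "transpose S ** A ** (Xk + W ** transpose A ** S ** transpose (transpose Z)) = transpose S"
    by (simp add: K_def matrix_add_ldistrib matrix_mul_assoc)
  from row_sols_eq(1)[OF A W refl this] show ?thesis
    by (simp add: Z_def K_def matrix_mul_assoc)
qed

section \<open>Column problems by transposition\<close>

lemma surj_transpose: "surj transpose"
  by (metis surjI transpose_transpose)

lemma mem_transpose_image_iff: "X \<in> transpose ` T \<longleftrightarrow> transpose X \<in> T"
  by (metis image_iff transpose_transpose)

lemma col_proj_sols_eq_transpose:
  assumes W: "sym_pos_def W"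
  shows "col_proj_sols A W Xk S = transpose ` row_proj_sols (transpose A) W (transpose Xk) S"
proof -
  have norm: "wfrob_norm (matrix_inv W) (transpose X - transpose Xk)
      = wfrob_norm (matrix_inv W) (X - Xk)" for X
    using wfrob_norm_transpose[OF sym_pos_def_transpose[OF sym_pos_def_matrix_inv[OF W]], of "X - Xk"]
    by (simp add: transpose_diff)
  have feas: "transpose S ** transpose A ** transpose X = transpose S \<longleftrightarrow> X ** A ** S = S" for X
    using transpose_iff[of "X ** A ** S" S] by (simp add: matrix_transpose_mul matrix_mul_assoc)
  show ?thesis
    unfolding set_eq_iff mem_transpose_image_iff
    unfolding row_proj_sols_def col_proj_sols_def mem_Collect_eq
    by (intro allI is_arg_min_surj[symmetric] surj_transpose) (simp_all only: norm feas)
qed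

lemma col_approx_sols_eq_transpose:
  fixes A W Xk :: "real^'n^'n" and S :: "real^'q^'n"
  assumes A: "invertible A" and W: "sym_pos_def W"
  shows "col_approx_sols A W Xk S = transpose ` row_approx_sols (transpose A) W (transpose Xk) S"
proof -
  have norm: "wfrob_norm (matrix_inv W) (transpose X - matrix_inv (transpose A))
      = wfrob_norm (matrix_inv W) (X - matrix_inv A)" for X
    using wfrob_norm_transpose[OF sym_pos_def_transpose[OF sym_pos_def_matrix_inv[OF W]],
        of "X - matrix_inv A"]
    by (simp add: transpose_diff matrix_inv_transpose[OF A])
  have feas: "transpose X = transpose Xk + W ** transpose (transpose A) ** S ** transpose Y
      \<longleftrightarrow> X = Xk + Y ** transpose S ** transpose A ** W" for X and Y :: "real^'q^'n"
    using transpose_iff[of X "Xk + Y ** transpose S ** transpose A ** W"]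
    by (simp add: transpose_add matrix_transpose_mul matrix_mul_assoc sym_pos_def_transpose[OF W])
  \<comment> \<open>Only \<open>X\<close> is transposed: the row constraint contains
    \<open>transpose Y\<close>, so its transpose already contains \<open>Y\<close>.\<close>
  let ?h = "map_prod transpose id :: (real^'n^'n) \<times> (real^'q^'n) \<Rightarrow> _"
  have "surj ?h"
    by (intro map_prod_surj surj_transpose surj_id)
  have "is_arg_min (\<lambda>(X, Y). 1/2 * (wfrob_norm (matrix_inv W) (X - matrix_inv (transpose A)))\<^sup>2)
      (\<lambda>(X, Y). X = transpose Xk + W ** transpose (transpose A) ** S ** transpose Y) (?h (X, Y))
    \<longleftrightarrow> is_arg_min (\<lambda>(X, Y). 1/2 * (wfrob_norm (matrix_inv W) (X - matrix_inv A))\<^sup>2)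
      (\<lambda>(X, Y). X = Xk + Y ** transpose S ** transpose A ** W) (X, Y)" for X and Y :: "real^'q^'n"
    by (rule is_arg_min_surj[OF \<open>surj ?h\<close>])
      (simp_all only: split_paired_all map_prod_simp prod.case id_apply norm feas)
  then show ?thesis
    unfolding set_eq_iff mem_transpose_image_iff row_approx_sols_def col_approx_sols_def mem_Collect_eq
    by simp
qed

theorem theorem4p1:
  fixes A W Xk :: "real^'n^'n" and S :: "real^'q^'n"
  assumes "invertible A" and "sym_pos_def W"
  shows "(\<exists>X'. row_proj_sols A W Xk S = {X'} \<and> row_approx_sols A W Xk S = {X'}) \<and>
    (\<exists>X'. col_proj_sols A W Xk S = {X'} \<and> col_approx_sols A W Xk S = {X'}) \<and>
    (rank S = CARD('q) \<longrightarrow>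
       invertible (transpose S ** A ** W ** transpose A ** S) \<and>
       row_proj_sols A W Xk S =
         {Xk + W ** transpose A ** S ** matrix_inv (transpose S ** A ** W ** transpose A ** S)
               ** transpose S ** (mat 1 - A ** Xk)} \<and>
       invertible (transpose S ** transpose A ** W ** A ** S) \<and>
       col_proj_sols A W Xk S =
         {Xk + (mat 1 - Xk ** A) ** S
               ** matrix_inv (transpose S ** transpose A ** W ** A ** S)
               ** transpose S ** transpose A ** W})"
proof (intro conjI impI)
  note A' = transpose_invertible[OF assms(1)]
  show "\<exists>X'. row_proj_sols A W Xk S = {X'} \<and> row_approx_sols A W Xk S = {X'}"
    by (rule row_sols_exist[OF assms])
  obtain X where "row_proj_sols (transpose A) W (transpose Xk) S = {X}"
    "row_approx_sols (transpose A) W (transpose Xk) S = {X}"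
    using row_sols_exist[OF A' assms(2)] by blast
  then show "\<exists>X'. col_proj_sols A W Xk S = {X'} \<and> col_approx_sols A W Xk S = {X'}"
    by (simp add: col_proj_sols_eq_transpose[OF assms(2)] col_approx_sols_eq_transpose[OF assms])
  assume S: "rank S = CARD('q)"
  show "invertible (transpose S ** A ** W ** transpose A ** S)"
    by (rule gram_invertible[OF assms S])
  show "row_proj_sols A W Xk S =
         {Xk + W ** transpose A ** S ** matrix_inv (transpose S ** A ** W ** transpose A ** S)
               ** transpose S ** (mat 1 - A ** Xk)}"
    by (rule row_proj_sols_full_rank[OF assms S])
  show inv: "invertible (transpose S ** transpose A ** W ** A ** S)"
    using gram_invertible[OF A' assms(2) S] by simp
  \<comment> \<open>Transposing the row formula for A^T and Xk^T transposes the inverse Gram matrix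
    as well; the Gram matrix is symmetric, so its inverse is unchanged.\<close>
  have "transpose (matrix_inv (transpose S ** transpose A ** W ** A ** S))
      = matrix_inv (transpose S ** transpose A ** W ** A ** S)"
    by (simp add: matrix_transpose_mul sym_pos_def_transpose[OF assms(2)] matrix_mul_assoc
        flip: matrix_inv_transpose[OF inv])
  then show "col_proj_sols A W Xk S =
         {Xk + (mat 1 - Xk ** A) ** S
               ** matrix_inv (transpose S ** transpose A ** W ** A ** S)
               ** transpose S ** transpose A ** W}"
    by (simp add: col_proj_sols_eq_transpose[OF assms(2)] row_proj_sols_full_rank[OF A' assms(2) S]
        transpose_add transpose_diff matrix_transpose_mul sym_pos_def_transpose[OF assms(2)]
        matrix_mul_assoc)
qed

end
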